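(* Given an evolution algebra $\mathcal{E}=(V,\mu)$ over a field $\mathbb{K}$, there exists a bijection between the set of equivalence classes of infinitesimal deformations of $\mathcal{E}$ and the set of elements of the second cohomology space $\mathcal{H}^2(\mathcal{E})$.
   Context: An evolution algebra over a field $\mathbb{K}$ is a pair $\mathcal{E}=(V,\mu)$, where $V$ is a finite-dimensional $\mathbb{K}$-vector space and $\mu\colon V\times V\to V$ is a bilinear map admitting a basis $B=\{e_1,\dots,e_n\}$ (a natural basis, here fixed) with $\mu(e_i,e_j)=0$ for $i\neq j$. $\mathcal{Z}^2(V)$ is the space of bilinear maps $\theta\colon V\times V\to V$ with $\theta(e_i,e_j)=0$ for all $i\ne j$. For $\varphi\in\operatorname{End}_{\mathbb{K}}(V)$ put $\delta_\mu\varphi(u,v)=\varphi(\mu(u,v))-\mu(u,\varphi(v))-\mu(\varphi(u),v)$. The space of $2$-coboundaries is $\mathcal{B}^2(\mathcal{E})=\{\theta\in\mathcal{Z}^2(V):\theta=\delta_\mu\varphi\text{ for some }\varphi\in\operatorname{End}_{\mathbb{K}}(V)\}$, and the second cohomology space is $\mathcal{H}^2(\mathcal{E})=\mathcal{Z}^2(V)/\mathcal{B}^2(\mathcal{E})$. An infinitesimal deformation of $\mathcal{E}$ is a $\mathbb{K}[t]/(t^2)$-bilinear product $\nu_t=\mu+t\nu_1$ on $V\otimes\mathbb{K}[t]/(t^2)$ with $\nu_1\in\mathcal{Z}^2(V)$. Two infinitesimal deformations $\nu_t,\lambda_t$ are equivalent if there is $\phi_t=\operatorname{Id}+t\phi_1$,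 with $\phi_1\in\operatorname{End}_{\mathbb{K}}(V)$, such that $\phi_t(\nu_t(u,v))=\lambda_t(\phi_t(u),\phi_t(v))$ modulo $t^2$ for all $u,v\in V$. *)

theory Defs
  imports "HOL-Computational_Algebra.Polynomial" "HOL-Library.Product_Plus"
begin

section \<open>The ring \<open>K[t]/(t\<^sup>2)\<close>\<close>

definition cong_t2 :: "'k::field poly \<Rightarrow> 'k poly \<Rightarrow> bool"
  where "cong_t2 p q \<longleftrightarrow> monom 1 2 dvd p - q"

lemma equivp_cong_t2: "equivp (cong_t2 :: 'k::field poly \<Rightarrow> _)"
proof (rule equivpI)
  show "reflp (cong_t2 :: 'k poly \<Rightarrow> _)"
    by (auto simp: reflp_def cong_t2_def)
  show "symp (cong_t2 :: 'k poly \<Rightarrow> _)"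
    by (auto simp: symp_def cong_t2_def dvd_diff_commute)
  show "transp (cong_t2 :: 'k poly \<Rightarrow> _)"
  proof (rule transpI)
    fix p q r :: "'k poly"
    assume "cong_t2 p q" "cong_t2 q r"
    then have "monom 1 2 dvd (p - q) + (q - r)"
      unfolding cong_t2_def by (rule dvd_add)
    then show "cong_t2 p r" by (simp add: cong_t2_def)
  qed
qed

quotient_type (overloaded) 'k mod_t2 = "'k::field poly" / cong_t2
  by (rule equivp_cong_t2)

instantiation mod_t2 :: (field) comm_ring_1
begin

lift_definition zero_mod_t2 :: "'a mod_t2" is 0 .

lift_definition one_mod_t2 :: "'a mod_t2" is 1 .

lift_definition plus_mod_t2 :: "'a mod_t2 \<Rightarrow> 'a mod_t2 \<Rightarrow> 'a mod_t2" is "(+)"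
proof -
  fix p q r s :: "'a poly"
  assume "cong_t2 p q" "cong_t2 r s"
  then have "monom 1 2 dvd (p - q) + (r - s)"
    unfolding cong_t2_def by (rule dvd_add)
  then show "cong_t2 (p + r) (q + s)" by (simp add: cong_t2_def algebra_simps)
qed

lift_definition uminus_mod_t2 :: "'a mod_t2 \<Rightarrow> 'a mod_t2" is uminus
  unfolding cong_t2_def by (metis dvd_minus_iff minus_diff_minus)

lift_definition minus_mod_t2 :: "'a mod_t2 \<Rightarrow> 'a mod_t2 \<Rightarrow> 'a mod_t2" is "(-)"
proof -
  fix p q r s :: "'a poly"
  assume "cong_t2 p q" "cong_t2 r s"
  then have "monom 1 2 dvd (p - q) - (r - s)"
    unfolding cong_t2_def by (rule dvd_diff)
  then show "cong_t2 (p - r) (q - s)" by (simp add: cong_t2_def algebra_simps)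
qed

lift_definition times_mod_t2 :: "'a mod_t2 \<Rightarrow> 'a mod_t2 \<Rightarrow> 'a mod_t2" is "(*)"
proof -
  fix p q r s :: "'a poly"
  assume "cong_t2 p q" "cong_t2 r s"
  then have "monom 1 2 dvd (p - q) * r + q * (r - s)"
    unfolding cong_t2_def by (intro dvd_add dvd_mult2 dvd_mult)
  then show "cong_t2 (p * r) (q * s)" by (simp add: cong_t2_def algebra_simps)
qed

instance
proof
  show "(0::'a mod_t2) \<noteq> 1"
    by transfer (auto simp: cong_t2_def dvd_diff_commute[of _ 0 1] dest!: dvd_imp_degree_le
        simp: degree_monom_eq)
qed (transfer; simp add: cong_t2_def algebra_simps)+

end

lift_definition const_mod_t2 :: "'k::field \<Rightarrow> 'k mod_t2" is "\<lambda>c. [:c:]" .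

lift_definition t_mod_t2 :: "'k::field mod_t2" is "monom 1 1" .

lemma cong_t2_coeff: "cong_t2 p q \<Longrightarrow> n < 2 \<Longrightarrow> coeff p n = coeff q n"
  by (auto simp: cong_t2_def dvd_def coeff_monom_mult dest!: arg_cong[where f = "\<lambda>p. coeff p n"])

lift_definition coeff0 :: "'k::field mod_t2 \<Rightarrow> 'k" is "\<lambda>p. coeff p 0"
  by (rule cong_t2_coeff) auto

lift_definition coeff1 :: "'k::field mod_t2 \<Rightarrow> 'k" is "\<lambda>p. coeff p 1"
  by (rule cong_t2_coeff) auto

lemma mod_t2_decomp: "p = const_mod_t2 (coeff0 p) + const_mod_t2 (coeff1 p) * t_mod_t2"
  for p :: "'k::field mod_t2"
proof (transfer)
  fix p :: "'k poly"
  have "p = [:coeff p 0:] + [:coeff p 1:] * monom 1 1 + monom 1 2 * poly_shift 2 p"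
    by (intro poly_eqI) (auto simp: coeff_monom_mult coeff_poly_shift coeff_pCons
        numeral_2_eq_2 monom_altdef split: nat.splits)
  then have "p - ([:coeff p 0:] + [:coeff p 1:] * monom 1 1) = monom 1 2 * poly_shift 2 p"
    by (metis add_diff_cancel_left')
  then show "cong_t2 p ([:coeff p 0:] + [:coeff p 1:] * monom 1 1)"
    unfolding cong_t2_def by (metis dvd_triv_left)
qed

lemma coeff_mod_t2 [simp]:
  "coeff0 0 = 0" "coeff1 0 = 0" "coeff0 1 = 1" "coeff1 1 = 0"
  "coeff0 (p + q) = coeff0 p + coeff0 q" "coeff1 (p + q) = coeff1 p + coeff1 q"
  "coeff0 (p * q) = coeff0 p * coeff0 q"
  "coeff1 (p * q) = coeff0 p * coeff1 q + coeff1 p * coeff0 q"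
  "coeff0 (const_mod_t2 c) = c" "coeff1 (const_mod_t2 c) = 0"
  "coeff0 (t_mod_t2 :: 'k mod_t2) = 0" "coeff1 (t_mod_t2 :: 'k mod_t2) = 1"
  for p q :: "'k::field mod_t2"
  by (transfer; simp add: coeff_mult)+

section \<open>The module obtained from \<open>V\<close> by extending scalars to \<open>K[t]/(t\<^sup>2)\<close>\<close>

text \<open>Since \<open>K[t]/(t\<^sup>2)\<close> has the \<open>K\<close>-basis \<open>1, t\<close>, the pair \<open>(v\<^sub>0, v\<^sub>1)\<close> stands for the
  element \<open>v\<^sub>0 \<otimes> 1 + v\<^sub>1 \<otimes> t\<close> of \<open>V \<otimes> K[t]/(t\<^sup>2)\<close>; in particular \<open>V\<close> sits inside as the pairs
  \<open>(v, 0)\<close>. Lemma \<open>ext_scale_universal\<close> below is the universal property of that tensor product.\<close>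

definition ext_scale :: "('k::field \<Rightarrow> 'v::ab_group_add \<Rightarrow> 'v) \<Rightarrow> 'k mod_t2 \<Rightarrow> 'v \<times> 'v \<Rightarrow> 'v \<times> 'v"
  where "ext_scale scale p w =
    (scale (coeff0 p) (fst w), scale (coeff0 p) (snd w) + scale (coeff1 p) (fst w))"

lemma module_ext_scale:
  assumes "vector_space scale"
  shows "module (ext_scale scale)"
proof -
  interpret vector_space scale by fact
  show ?thesis
    by unfold_locales
      (auto simp: ext_scale_def scale_right_distrib scale_left_distrib prod_eq_iff add_ac mult_ac)
qed

lemma ext_scale_universal:
  assumes V: "vector_space (scale :: 'k::field \<Rightarrow> 'v::ab_group_add \<Rightarrow> 'v)"
    and W: "module (wscale :: 'k mod_t2 \<Rightarrow> 'w::ab_group_add \<Rightarrow> 'w)"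
    and f: "module_hom scale (\<lambda>c. wscale (const_mod_t2 c)) f"
  shows "\<exists>!g. module_hom (ext_scale scale) wscale g \<and> (\<forall>v. g (v, 0) = f v)"
proof -
  interpret vector_space scale by fact
  interpret W: module wscale by fact
  interpret f: module_hom scale "\<lambda>c. wscale (const_mod_t2 c)" f by fact
  interpret E: module "ext_scale scale" by (rule module_ext_scale) fact
  have tt: "t_mod_t2 * t_mod_t2 = (0 :: 'k mod_t2)"
    by transfer (simp add: cong_t2_def mult_monom numeral_2_eq_2)
  have dec: "w = (fst w, 0) + ext_scale scale t_mod_t2 (snd w, 0)" for w
    by (simp add: ext_scale_def prod_eq_iff)
  define g where "g w = f (fst w) + wscale t_mod_t2 (f (snd w))" for w
  have sc: "wscale p x = wscale (const_mod_t2 (coeff0 p)) x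
      + wscale (const_mod_t2 (coeff1 p)) (wscale t_mod_t2 x)" for p x
    by (subst mod_t2_decomp[of p]) (simp add: W.scale_left_distrib)
  have "module_hom (ext_scale scale) wscale g"
  proof
    show "g (b1 + b2) = g b1 + g b2" for b1 b2
      by (simp add: g_def f.add W.scale_right_distrib add_ac)
    show "g (ext_scale scale r b) = wscale r (g b)" for r b
      unfolding sc[of r "g b"]
      by (simp add: g_def ext_scale_def f.add f.scale W.scale_right_distrib tt mult_ac add_ac)
  qed
  moreover have "g (v, 0) = f v" for v by (simp add: g_def)
  moreover have "h = g" if h: "module_hom (ext_scale scale) wscale h" "\<forall>v. h (v, 0) = f v" for h
  proof
    fix w
    interpret h: module_hom "ext_scale scale" wscale h by fact
    show "h w = g w"
      by (subst dec[of w]) (simp add: h.add h.scale h(2) g_def)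
  qed
  ultimately show ?thesis by blast
qed

section \<open>Evolution algebras and their second cohomology\<close>

definition bilinear_map :: "('r::comm_ring_1 \<Rightarrow> 'm::ab_group_add \<Rightarrow> 'm) \<Rightarrow> ('m \<Rightarrow> 'm \<Rightarrow> 'm) \<Rightarrow> bool"
  where "bilinear_map scale f \<longleftrightarrow>
    (\<forall>u. module_hom scale scale (\<lambda>v. f u v)) \<and> (\<forall>v. module_hom scale scale (\<lambda>u. f u v))"

text \<open>The basis \<open>B\<close> of \<open>finite_dimensional_vector_space\<close> is the fixed natural basis.\<close>

locale evolution_algebra = finite_dimensional_vector_space scale B
  for scale :: "'k::field \<Rightarrow> 'v::ab_group_add \<Rightarrow> 'v" and B :: "'v set" +
  fixes \<mu> :: "'v \<Rightarrow> 'v \<Rightarrow> 'v"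
  assumes bilinear: "bilinear_map scale \<mu>"
    and natural_basis: "\<And>e f. e \<in> B \<Longrightarrow> f \<in> B \<Longrightarrow> e \<noteq> f \<Longrightarrow> \<mu> e f = 0"

definition cocycles2 :: "('k::field \<Rightarrow> 'v::ab_group_add \<Rightarrow> 'v) \<Rightarrow> 'v set \<Rightarrow> ('v \<Rightarrow> 'v \<Rightarrow> 'v) set"
  where "cocycles2 scale B =
    {\<theta>. bilinear_map scale \<theta> \<and> (\<forall>e\<in>B. \<forall>f\<in>B. e \<noteq> f \<longrightarrow> \<theta> e f = 0)}"

definition coboundary :: "('v \<Rightarrow> 'v \<Rightarrow> 'v) \<Rightarrow> ('v \<Rightarrow> 'v) \<Rightarrow> 'v \<Rightarrow> 'v \<Rightarrow> 'v::ab_group_add"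
  where "coboundary \<mu> \<phi> u v = \<phi> (\<mu> u v) - \<mu> u (\<phi> v) - \<mu> (\<phi> u) v"

definition coboundaries2 ::
    "('k::field \<Rightarrow> 'v::ab_group_add \<Rightarrow> 'v) \<Rightarrow> 'v set \<Rightarrow> ('v \<Rightarrow> 'v \<Rightarrow> 'v) \<Rightarrow> ('v \<Rightarrow> 'v \<Rightarrow> 'v) set"
  where "coboundaries2 scale B \<mu> =
    {\<theta> \<in> cocycles2 scale B. \<exists>\<phi>. Vector_Spaces.linear scale scale \<phi> \<and> \<theta> = coboundary \<mu> \<phi>}"

definition cohomologous ::
    "('k::field \<Rightarrow> 'v::ab_group_add \<Rightarrow> 'v) \<Rightarrow> 'v set \<Rightarrow> ('v \<Rightarrow> 'v \<Rightarrow> 'v) \<Rightarrow> (('v \<Rightarrow> 'v \<Rightarrow> 'v) \<times> ('v \<Rightarrow> 'v \<Rightarrow> 'v)) set"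
  where "cohomologous scale B \<mu> =
    {(\<theta>, \<eta>). \<theta> \<in> cocycles2 scale B \<and> \<eta> \<in> cocycles2 scale B \<and>
      (\<lambda>u v. \<theta> u v - \<eta> u v) \<in> coboundaries2 scale B \<mu>}"

definition cohomology2 ::
    "('k::field \<Rightarrow> 'v::ab_group_add \<Rightarrow> 'v) \<Rightarrow> 'v set \<Rightarrow> ('v \<Rightarrow> 'v \<Rightarrow> 'v) \<Rightarrow> ('v \<Rightarrow> 'v \<Rightarrow> 'v) set set"
  where "cohomology2 scale B \<mu> = cocycles2 scale B // cohomologous scale B \<mu>"

section \<open>Infinitesimal deformations\<close>

text \<open>\<open>\<nu> = \<mu> + t \<nu>\<^sub>1\<close> is prescribed on \<open>V\<close>; bilinearity over \<open>K[t]/(t\<^sup>2)\<close> determines it elsewhere.\<close>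

definition infinitesimal_deformations ::
    "('k::field \<Rightarrow> 'v::ab_group_add \<Rightarrow> 'v) \<Rightarrow> 'v set \<Rightarrow> ('v \<Rightarrow> 'v \<Rightarrow> 'v) \<Rightarrow> ('v \<times> 'v \<Rightarrow> 'v \<times> 'v \<Rightarrow> 'v \<times> 'v) set"
  where "infinitesimal_deformations scale B \<mu> =
    {\<nu>. bilinear_map (ext_scale scale) \<nu> \<and>
      (\<exists>\<nu>1\<in>cocycles2 scale B. \<forall>u v. \<nu> (u, 0) (v, 0) = (\<mu> u v, \<nu>1 u v))}"

text \<open>\<open>\<phi>\<close> is \<open>\<phi>\<^sub>t = Id + t \<phi>\<^sub>1\<close>, extended \<open>K[t]/(t\<^sup>2)\<close>-linearly; working modulo \<open>t\<^sup>2\<close> is built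
  into the type of its values.\<close>

definition deformation_equiv ::
    "('k::field \<Rightarrow> 'v::ab_group_add \<Rightarrow> 'v) \<Rightarrow> 'v set \<Rightarrow> ('v \<Rightarrow> 'v \<Rightarrow> 'v) \<Rightarrow>
      (('v \<times> 'v \<Rightarrow> 'v \<times> 'v \<Rightarrow> 'v \<times> 'v) \<times> ('v \<times> 'v \<Rightarrow> 'v \<times> 'v \<Rightarrow> 'v \<times> 'v)) set"
  where "deformation_equiv scale B \<mu> =
    {(\<nu>, \<kappa>). \<nu> \<in> infinitesimal_deformations scale B \<mu> \<and> \<kappa> \<in> infinitesimal_deformations scale B \<mu> \<and>
      (\<exists>\<phi> \<phi>1. module_hom (ext_scale scale) (ext_scale scale) \<phi> \<and>
        Vector_Spaces.linear scale scale \<phi>1 \<and> (\<forall>u. \<phi> (u, 0) = (u, \<phi>1 u)) \<and>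
        (\<forall>u v. \<phi> (\<nu> (u, 0) (v, 0)) = \<kappa> (\<phi> (u, 0)) (\<phi> (v, 0))))}"

text \<open>Both relations are equivalence relations, so the quotients above consist of equivalence
  classes and of cosets of the coboundaries, respectively.\<close>

context evolution_algebra
begin

lemma cocycles2_zero: "(\<lambda>u v. 0) \<in> cocycles2 scale B"
  unfolding cocycles2_def bilinear_map_def module_hom_iff by (simp add: module_axioms)

lemma cocycles2_diff:
  "\<theta> \<in> cocycles2 scale B \<Longrightarrow> \<eta> \<in> cocycles2 scale B \<Longrightarrow> (\<lambda>u v. \<theta> u v - \<eta> u v) \<in> cocycles2 scale B"
  unfolding cocycles2_def bilinear_map_def module_hom_iff
  by (simp add: scale_right_diff_distrib)

lemma coboundaries2_zero: "(\<lambda>u v. 0) \<in> coboundaries2 scale B \<mu>"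
proof -
  have "Vector_Spaces.linear scale scale (\<lambda>x. 0)"
    by unfold_locales auto
  moreover have "\<mu> u 0 = 0 \<and> \<mu> 0 u = 0" for u
    using bilinear unfolding bilinear_map_def by (metis module_hom.zero)
  then have "(\<lambda>u v. 0) = coboundary \<mu> (\<lambda>x. 0)"
    by (auto simp: coboundary_def fun_eq_iff)
  ultimately show ?thesis
    unfolding coboundaries2_def using cocycles2_zero by blast
qed

lemma coboundaries2_diff:
  assumes "\<theta> \<in> coboundaries2 scale B \<mu>" "\<eta> \<in> coboundaries2 scale B \<mu>"
  shows "(\<lambda>u v. \<theta> u v - \<eta> u v) \<in> coboundaries2 scale B \<mu>"
proof -
  obtain \<phi> \<psi> where lin: "Vector_Spaces.linear scale scale \<phi>" "Vector_Spaces.linear scale scale \<psi>"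
    and eq: "\<theta> = coboundary \<mu> \<phi>" "\<eta> = coboundary \<mu> \<psi>"
    using assms unfolding coboundaries2_def by blast
  interpret f: Vector_Spaces.linear scale scale \<phi> by (fact lin)
  interpret g: Vector_Spaces.linear scale scale \<psi> by (fact lin)
  have "Vector_Spaces.linear scale scale (\<lambda>x. \<phi> x - \<psi> x)"
    by unfold_locales (simp_all add: f.add g.add f.scale g.scale scale_right_diff_distrib)
  moreover have "\<mu> u (a - b) = \<mu> u a - \<mu> u b \<and> \<mu> (a - b) u = \<mu> a u - \<mu> b u" for u a b
  proof
    show "\<mu> u (a - b) = \<mu> u a - \<mu> u b"
      using bilinear unfolding bilinear_map_def by (intro module_hom.diff[of scale scale "\<mu> u"]) blast
    show "\<mu> (a - b) u = \<mu> a u - \<mu> b u"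
      using bilinear unfolding bilinear_map_def
      by (intro module_hom.diff[of scale scale "\<lambda>x. \<mu> x u"]) blast
  qed
  then have "(\<lambda>u v. \<theta> u v - \<eta> u v) = coboundary \<mu> (\<lambda>x. \<phi> x - \<psi> x)"
    by (simp add: eq coboundary_def fun_eq_iff)
  ultimately show ?thesis
    using assms cocycles2_diff unfolding coboundaries2_def by blast
qed

lemma coboundaries2_uminus:
  assumes "(\<lambda>u v. \<theta> u v - \<eta> u v) \<in> coboundaries2 scale B \<mu>"
  shows "(\<lambda>u v. \<eta> u v - \<theta> u v) \<in> coboundaries2 scale B \<mu>"
  using coboundaries2_diff[OF coboundaries2_zero assms] by simp

lemma coboundaries2_trans:
  assumes "(\<lambda>u v. \<theta> u v - \<eta> u v) \<in> coboundaries2 scale B \<mu>"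
    and "(\<lambda>u v. \<eta> u v - \<zeta> u v) \<in> coboundaries2 scale B \<mu>"
  shows "(\<lambda>u v. \<theta> u v - \<zeta> u v) \<in> coboundaries2 scale B \<mu>"
  using coboundaries2_diff[OF assms(1) coboundaries2_uminus[OF assms(2)]] by simp

lemma equiv_cohomologous: "equiv (cocycles2 scale B) (cohomologous scale B \<mu>)"
proof (rule equivI)
  show "cohomologous scale B \<mu> \<subseteq> cocycles2 scale B \<times> cocycles2 scale B"
    by (auto simp: cohomologous_def)
  show "refl_on (cocycles2 scale B) (cohomologous scale B \<mu>)"
    by (auto simp: refl_on_def cohomologous_def coboundaries2_zero)
  show "sym (cohomologous scale B \<mu>)"
    by (auto simp: sym_def cohomologous_def intro: coboundaries2_uminus)
  show "trans (cohomologous scale B \<mu>)"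
  proof (rule transI)
    fix \<theta> \<eta> \<zeta> assume "(\<theta>, \<eta>) \<in> cohomologous scale B \<mu>" "(\<eta>, \<zeta>) \<in> cohomologous scale B \<mu>"
    then show "(\<theta>, \<zeta>) \<in> cohomologous scale B \<mu>"
      using coboundaries2_trans[of \<theta> \<eta> \<zeta>] by (simp add: cohomologous_def)
  qed
qed

lemma infinitesimal_deformation_apply:
  assumes "\<nu> \<in> infinitesimal_deformations scale B \<mu>"
    and \<nu>1: "\<And>u v. \<nu> (u, 0) (v, 0) = (\<mu> u v, \<nu>1 u v)"
  shows "\<nu> (u, a) (v, b) = (\<mu> u v, \<nu>1 u v + \<mu> u b + \<mu> a v)"
proof -
  have hom: "module_hom (ext_scale scale) (ext_scale scale) (\<nu> x)"
    "module_hom (ext_scale scale) (ext_scale scale) (\<lambda>y. \<nu> y x)" for x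
    using assms(1) unfolding infinitesimal_deformations_def bilinear_map_def by blast+
  have t0: "ext_scale scale t_mod_t2 (x, y) = (0, x)" for x y
    by (simp add: ext_scale_def)
  have dec: "(x, y) = (x, 0) + ext_scale scale t_mod_t2 (y, 0)" for x y
    by (simp add: t0)
  have "\<nu> (u, a) (v, b) = \<nu> (u, 0) (v, b) + ext_scale scale t_mod_t2 (\<nu> (a, 0) (v, b))"
    by (subst dec[of u a]) (simp only: module_hom.add[OF hom(2)] module_hom.scale[OF hom(2)])
  moreover have "\<nu> (x, 0) (v, b) = (\<mu> x v, \<nu>1 x v + \<mu> x b)" for x
    by (subst dec[of v b], simp only: module_hom.add[OF hom(1)] module_hom.scale[OF hom(1)])
      (simp add: \<nu>1 t0)
  ultimately show ?thesis by (simp add: t0)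
qed

lemma deformation_equiv_iff:
  assumes \<nu>: "\<nu> \<in> infinitesimal_deformations scale B \<mu>"
    and \<kappa>: "\<kappa> \<in> infinitesimal_deformations scale B \<mu>"
    and \<nu>1: "\<And>u v. \<nu> (u, 0) (v, 0) = (\<mu> u v, \<nu>1 u v)" "\<nu>1 \<in> cocycles2 scale B"
    and \<kappa>1: "\<And>u v. \<kappa> (u, 0) (v, 0) = (\<mu> u v, \<kappa>1 u v)" "\<kappa>1 \<in> cocycles2 scale B"
  shows "(\<nu>, \<kappa>) \<in> deformation_equiv scale B \<mu> \<longleftrightarrow>
    (\<lambda>u v. \<kappa>1 u v - \<nu>1 u v) \<in> coboundaries2 scale B \<mu>"
proof
  have hom_apply: "\<phi> (u, a) = (u, a + \<phi>1 u)"
    if "module_hom (ext_scale scale) (ext_scale scale) \<phi>" "\<forall>u. \<phi> (u, 0) = (u, \<phi>1 u)" for \<phi> \<phi>1 u a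
  proof -
    interpret h: module_hom "ext_scale scale" "ext_scale scale" \<phi> by fact
    have "(u, a) = (u, 0) + ext_scale scale t_mod_t2 (a, 0)"
      by (simp add: ext_scale_def)
    then show ?thesis
      by (simp only: h.add h.scale that(2)) (simp add: ext_scale_def add.commute)
  qed
  {
    assume "(\<nu>, \<kappa>) \<in> deformation_equiv scale B \<mu>"
    then obtain \<phi> \<phi>1 where \<phi>: "module_hom (ext_scale scale) (ext_scale scale) \<phi>"
        "Vector_Spaces.linear scale scale \<phi>1" "\<forall>u. \<phi> (u, 0) = (u, \<phi>1 u)"
      and eq: "\<And>u v. \<phi> (\<nu> (u, 0) (v, 0)) = \<kappa> (\<phi> (u, 0)) (\<phi> (v, 0))"
      unfolding deformation_equiv_def by blast
    have "\<kappa>1 u v - \<nu>1 u v = coboundary \<mu> \<phi>1 u v" for u v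
      using eq[of u v] unfolding \<phi>(3)[rule_format] \<nu>1(1) hom_apply[OF \<phi>(1,3)]
        infinitesimal_deformation_apply[OF \<kappa> \<kappa>1(1)]
      by (simp add: coboundary_def algebra_simps)
    then show "(\<lambda>u v. \<kappa>1 u v - \<nu>1 u v) \<in> coboundaries2 scale B \<mu>"
      using \<phi>(2) cocycles2_diff[OF \<kappa>1(2) \<nu>1(2)] unfolding coboundaries2_def by blast
  next
    assume "(\<lambda>u v. \<kappa>1 u v - \<nu>1 u v) \<in> coboundaries2 scale B \<mu>"
    then obtain \<phi>1 where lin: "Vector_Spaces.linear scale scale \<phi>1"
      and eq: "\<And>u v. \<kappa>1 u v - \<nu>1 u v = coboundary \<mu> \<phi>1 u v"
      unfolding coboundaries2_def by (auto simp: fun_eq_iff)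
    interpret l: Vector_Spaces.linear scale scale \<phi>1 by fact
    define \<phi> where "\<phi> = (\<lambda>w. (fst w, snd w + \<phi>1 (fst w)))"
    have "module_hom (ext_scale scale) (ext_scale scale) \<phi>"
      using module_ext_scale[OF vector_space_axioms] unfolding module_hom_iff
      by (auto simp: \<phi>_def ext_scale_def l.add l.scale algebra_simps)
    moreover have "\<phi> (\<nu> (u, 0) (v, 0)) = \<kappa> (\<phi> (u, 0)) (\<phi> (v, 0))" for u v
      using eq[of u v] unfolding \<nu>1(1)
      by (simp add: \<phi>_def infinitesimal_deformation_apply[OF \<kappa> \<kappa>1(1)] coboundary_def algebra_simps)
    moreover have "\<forall>u. \<phi> (u, 0) = (u, \<phi>1 u)" by (simp add: \<phi>_def)
    ultimately show "(\<nu>, \<kappa>) \<in> deformation_equiv scale B \<mu>"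
      using \<nu> \<kappa> lin unfolding deformation_equiv_def by blast
  }
qed

lemma equiv_deformation_equiv:
  "equiv (infinitesimal_deformations scale B \<mu>) (deformation_equiv scale B \<mu>)"
proof -
  let ?D = "infinitesimal_deformations scale B \<mu>" and ?R = "deformation_equiv scale B \<mu>"
  have "\<forall>\<nu>\<in>?D. \<exists>\<nu>1\<in>cocycles2 scale B. \<forall>u v. \<nu> (u, 0) (v, 0) = (\<mu> u v, \<nu>1 u v)"
    by (auto simp: infinitesimal_deformations_def)
  then obtain c where c: "\<And>\<nu>. \<nu> \<in> ?D \<Longrightarrow> c \<nu> \<in> cocycles2 scale B"
      "\<And>\<nu> u v. \<nu> \<in> ?D \<Longrightarrow> \<nu> (u, 0) (v, 0) = (\<mu> u v, c \<nu> u v)"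
    by metis
  have R: "(\<nu>, \<kappa>) \<in> ?R \<longleftrightarrow> (\<lambda>u v. c \<kappa> u v - c \<nu> u v) \<in> coboundaries2 scale B \<mu>"
    if "\<nu> \<in> ?D" "\<kappa> \<in> ?D" for \<nu> \<kappa>
    using deformation_equiv_iff that c by blast
  have sub: "?R \<subseteq> ?D \<times> ?D" by (auto simp: deformation_equiv_def)
  show ?thesis
  proof (rule equivI)
    show "?R \<subseteq> ?D \<times> ?D" by (fact sub)
    show "refl_on ?D ?R"
      by (auto simp: refl_on_def R coboundaries2_zero)
    show "sym ?R"
    proof (rule symI)
      fix \<nu> \<kappa> assume *: "(\<nu>, \<kappa>) \<in> ?R"
      then have D: "\<nu> \<in> ?D" "\<kappa> \<in> ?D" using sub by auto
      show "(\<kappa>, \<nu>) \<in> ?R"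
        using * coboundaries2_uminus[of "c \<kappa>" "c \<nu>"] unfolding R[OF D] R[OF D(2,1)] by simp
    qed
    show "trans ?R"
    proof (rule transI)
      fix \<nu> \<kappa> \<rho> assume *: "(\<nu>, \<kappa>) \<in> ?R" "(\<kappa>, \<rho>) \<in> ?R"
      then have D: "\<nu> \<in> ?D" "\<kappa> \<in> ?D" "\<rho> \<in> ?D" using sub by auto
      show "(\<nu>, \<rho>) \<in> ?R"
        using * coboundaries2_trans[of "c \<rho>" "c \<kappa>" "c \<nu>"]
        unfolding R[OF D(1,2)] R[OF D(2,3)] R[OF D(1,3)] by simp
    qed
  qed
qed

end

end

theory Submission
  imports Defs
begin

text \<open>A deformation \<mu> + t\<nu>1 is sent to its t-coefficient \<nu>1. Comparing
  t-coefficients in \<phi>(\<nu>(u,v)) = \<kappa>(\<phi>(u),\<phi>(v)) for \<phi> = Id + t\<phi>1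
  leaves exactly \<kappa>1 - \<nu>1 = \<delta>\<phi>1, so deformations are equivalent iff their
  t-coefficients are cohomologous (\<open>deformation_equiv_iff_cohomologous\<close>). Every cocycle
  is such a coefficient (\<open>infinitesimal_part_image\<close>). A surjection that both preserves
  and reflects equivalence relations induces a bijection of quotients, here by taking images of
  classes (\<open>bij_betw_image_quotients\<close>).\<close>

lemma bij_betw_image_quotients:
  assumes r: "equiv A r" and s: "equiv C s" and surj: "g ` A = C"
    and rel: "\<And>x y. x \<in> A \<Longrightarrow> y \<in> A \<Longrightarrow> (x, y) \<in> r \<longleftrightarrow> (g x, g y) \<in> s"
  shows "bij_betw ((`) g) (A // r) (C // s)"
proof -
  have image_class: "g ` (r `` {x}) = s `` {g x}" if "x \<in> A" for x
  proof
    show "g ` (r `` {x}) \<subseteq> s `` {g x}"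
      using that rel equiv_type[OF r] by auto
    show "s `` {g x} \<subseteq> g ` (r `` {x})"
    proof
      fix z assume z: "z \<in> s `` {g x}"
      \<comment> \<open>Surjectivity supplies a preimage of \<open>z\<close>; since
        \<open>rel\<close> also reflects the relation, that preimage lies in the class of
        \<open>x\<close>.\<close>
      then obtain y where "y \<in> A" "z = g y"
        using surj equiv_type[OF s] by blast
      with z that show "z \<in> g ` (r `` {x})"
        by (auto simp: rel)
    qed
  qed
  have "inj_on ((`) g) (A // r)"
  proof (rule inj_onI)
    fix X Y assume "X \<in> A // r" "Y \<in> A // r" and eq: "g ` X = g ` Y"
    then obtain x y where xy: "x \<in> A" "X = r `` {x}" "y \<in> A" "Y = r `` {y}"
      by (auto elim!: quotientE)
    with eq surj have "(g x, g y) \<in> s"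
      by (intro eq_equiv_class[OF _ s]) (auto simp: image_class)
    with xy show "X = Y"
      by (metis rel equiv_class_eq[OF r])
  qed
  moreover have "(`) g ` (A // r) = C // s"
    unfolding quotient_def surj[symmetric] by (simp add: image_UN image_class)
  ultimately show ?thesis
    by (simp add: bij_betw_def)
qed

text \<open>On a deformation this names the \<nu>1 whose existence the definition of deformations
  asserts; the values on pairs \<open>(u, 0)\<close> make it unique.\<close>

definition infinitesimal_part :: "('v \<times> 'v \<Rightarrow> 'v \<times> 'v \<Rightarrow> 'v \<times> 'v) \<Rightarrow> 'v \<Rightarrow> 'v \<Rightarrow> 'v::ab_group_add"
  where "infinitesimal_part \<nu> u v = snd (\<nu> (u, 0) (v, 0))"

lemma infinitesimal_part_deformation:
  assumes "\<nu> \<in> infinitesimal_deformations scale B \<mu>"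
  shows "infinitesimal_part \<nu> \<in> cocycles2 scale B"
    and "\<nu> (u, 0) (v, 0) = (\<mu> u v, infinitesimal_part \<nu> u v)"
proof -
  obtain \<nu>1 where \<nu>1: "\<nu>1 \<in> cocycles2 scale B" "\<And>u v. \<nu> (u, 0) (v, 0) = (\<mu> u v, \<nu>1 u v)"
    using assms by (auto simp: infinitesimal_deformations_def)
  moreover from \<nu>1(2) have "infinitesimal_part \<nu> = \<nu>1"
    by (simp add: infinitesimal_part_def fun_eq_iff)
  ultimately show "infinitesimal_part \<nu> \<in> cocycles2 scale B"
    and "\<nu> (u, 0) (v, 0) = (\<mu> u v, infinitesimal_part \<nu> u v)"
    by simp_all
qed

text \<open>This is (u + ta)(v + tb) expanded for the product \<mu> + t\<theta>, with multiples of
  t^2 dropped.\<close>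

definition deformation_of_cocycle ::
    "('v \<Rightarrow> 'v \<Rightarrow> 'v) \<Rightarrow> ('v \<Rightarrow> 'v \<Rightarrow> 'v) \<Rightarrow> 'v \<times> 'v \<Rightarrow> 'v \<times> 'v \<Rightarrow> 'v \<times> 'v::ab_group_add"
  where "deformation_of_cocycle \<mu> \<theta> x y =
    (\<mu> (fst x) (fst y), \<theta> (fst x) (fst y) + \<mu> (fst x) (snd y) + \<mu> (snd x) (fst y))"

context evolution_algebra
begin

text \<open>Scaling one argument by \<open>p\<close> multiplies the t-coefficient by
  \<open>coeff0 p\<close> and adds \<open>coeff1 p\<close> times \<mu> of the first components, just
  as \<open>ext_scale\<close> acts on the product.\<close>

lemma bilinear_deformation_of_cocycle:
  assumes "bilinear_map scale \<theta>"
  shows "bilinear_map (ext_scale scale) (deformation_of_cocycle \<mu> \<theta>)"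
proof -
  have lin: "f (x + y) z = f x z + f y z" "f z (x + y) = f z x + f z y"
    "f (scale c x) z = scale c (f x z)" "f z (scale c x) = scale c (f z x)"
    if "bilinear_map scale f" for f x y z c
    using that by (simp_all add: bilinear_map_def module_hom_iff)
  show ?thesis
    unfolding bilinear_map_def module_hom_iff
    using module_ext_scale[OF vector_space_axioms]
    by (simp add: deformation_of_cocycle_def ext_scale_def lin[OF bilinear] lin[OF assms]
        scale_right_distrib mult.commute add_ac)
qed

lemma deformation_of_cocycle_in_deformations:
  assumes "\<theta> \<in> cocycles2 scale B"
  shows "deformation_of_cocycle \<mu> \<theta> \<in> infinitesimal_deformations scale B \<mu>"
    and "infinitesimal_part (deformation_of_cocycle \<mu> \<theta>) = \<theta>"
proof -
  have "\<mu> u 0 = 0" "\<mu> 0 u = 0" for u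
    using bilinear unfolding bilinear_map_def by (metis module_hom.zero)+
  then have eq: "deformation_of_cocycle \<mu> \<theta> (u, 0) (v, 0) = (\<mu> u v, \<theta> u v)" for u v
    by (simp add: deformation_of_cocycle_def)
  then show "infinitesimal_part (deformation_of_cocycle \<mu> \<theta>) = \<theta>"
    by (simp add: infinitesimal_part_def fun_eq_iff)
  show "deformation_of_cocycle \<mu> \<theta> \<in> infinitesimal_deformations scale B \<mu>"
    using assms eq bilinear_deformation_of_cocycle
    by (auto simp: infinitesimal_deformations_def cocycles2_def)
qed

text \<open>Surjectivity holds because \<open>deformation_of_cocycle\<close> is a right inverse on
  cocycles.\<close>

lemma infinitesimal_part_image:
  "infinitesimal_part ` infinitesimal_deformations scale B \<mu> = cocycles2 scale B"
  using infinitesimal_part_deformation(1) deformation_of_cocycle_in_deformations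
  by (force simp: image_iff)

lemma deformation_equiv_iff_cohomologous:
  assumes "\<nu> \<in> infinitesimal_deformations scale B \<mu>" "\<kappa> \<in> infinitesimal_deformations scale B \<mu>"
  shows "(\<nu>, \<kappa>) \<in> deformation_equiv scale B \<mu> \<longleftrightarrow>
    (infinitesimal_part \<nu>, infinitesimal_part \<kappa>) \<in> cohomologous scale B \<mu>"
  using deformation_equiv_iff[OF assms infinitesimal_part_deformation(2,1)[OF assms(1)]
      infinitesimal_part_deformation(2,1)[OF assms(2)]]
    infinitesimal_part_deformation(1)[OF assms(1)] infinitesimal_part_deformation(1)[OF assms(2)]
    \<comment> \<open>\<open>deformation_equiv_iff\<close> yields \<kappa>1 - \<nu>1, whereas
      \<open>cohomologous\<close> asks for \<nu>1 - \<kappa>1; negation reconciles the two.\<close>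
    coboundaries2_uminus
  by (auto simp: cohomologous_def)

end

theorem corollary4p3:
  fixes scale :: "'k::field \<Rightarrow> 'v::ab_group_add \<Rightarrow> 'v"
    and B :: "'v set"
    and \<mu> :: "'v \<Rightarrow> 'v \<Rightarrow> 'v"
  assumes "evolution_algebra scale B \<mu>"
  shows "\<exists>F. bij_betw F
    (infinitesimal_deformations scale B \<mu> // deformation_equiv scale B \<mu>)
    (cohomology2 scale B \<mu>)"
proof -
  interpret evolution_algebra scale B \<mu> by fact
  show ?thesis
    unfolding cohomology2_def
    using bij_betw_image_quotients[OF equiv_deformation_equiv equiv_cohomologous
        infinitesimal_part_image deformation_equiv_iff_cohomologous] by blast
qed

end
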